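(* Let $p$ be an odd prime, $q=p^e$, and let $k,l\ge 3$ be coprime to $p$ with $(k,l)$ hyperbolic, i.e. $1/k+1/l<1/2$. Let $\xi_\kappa,\xi_\lambda$ be primitive $2k$-th and $2l$-th roots of unity in $GF(q)$ or $GF(q^2)$, and let $\omega_\kappa=\xi_\kappa+\xi_\kappa^{-1}$, $\omega_\lambda=\xi_\lambda+\xi_\lambda^{-1}$. Consider the regular map of type $(k,l)$ given by the generating triple $(X,Y,Z)$ of matrices determined by $\xi_\kappa,\xi_\lambda$ described in the context, where $G=\langle X,Y,Z\rangle$ is isomorphic to $PSL(2,q)$ or $PGL(2,q)$. Then the map is Möbius regular if and only if $k$ is even and $\omega_\kappa^2+2\omega_\lambda^2=4$.
   Context: A regular map of type $(k,l)$ (vertex degree $k$, face length $l$) is identified with a group $G$ generated by three involutions $X,Y,Z$ such that $XY$, $YZ$, $ZX$ have orders exactly $2,k,l$ respectively; put $R=YZ$. A regular map is Möbius regular if any two distinct adjacent vertices are joined by exactly two edges and any open set supporting these edges contains a Möbius strip. By a known result (Li and Širáň), this is equivalent to the following group-theoretic condition, which may be taken as the definition: $k$ is even and $XR^{k/2}X=R^{k/2}Y$ in $G$. Matrices are regarded up to nonzero scalar multiples, i.e. as elements of $PGL(2,K)$ with $K$ an algebraic closure of $GF(p)$. For $k,l$ coprime to $p$, put $D=\omega_\kappa^2+\omega_\lambda^2-4$ (assumed nonzero), $\beta=-1/\sqrt{-D}$, $\eta=(\xi_\kappa-\xi_\kappa^{-1})^{-1}$. The generating triple is $$X=\eta\beta\begin{pmatrix}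 D & D\omega_\lambda\xi_\kappa\\ -\omega_\lambda\xi_\kappa^{-1} & -D\end{pmatrix},\quad Y=\beta\begin{pmatrix}0&\xi_\kappa D\\ \xi_\kappa^{-1}&0\end{pmatrix},\quad Z=\beta\begin{pmatrix}0&D\\1&0\end{pmatrix}.$$ *)

theory Defs
  imports "HOL-Analysis.Analysis" "HOL-Algebra.Algebraic_Closure_Type"
begin

locale regular_map = group G for G (structure) +
  fixes k l :: nat and x y z :: 'a
  assumes generators_closed: "x \<in> carrier G" "y \<in> carrier G" "z \<in> carrier G"
    and generated: "generate G {x, y, z} = carrier G"
    and involutions: "ord x = 2" "ord y = 2" "ord z = 2"
    and ord_xy: "ord (x \<otimes> y) = 2"
    and ord_yz: "ord (y \<otimes> z) = k"
    and ord_zx: "ord (z \<otimes> x) = l"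

text \<open>
  The group-theoretic form (Li and Siran) of the condition that any two distinct adjacent
  vertices are joined by exactly two edges and every open set supporting these two edges
  contains a Moebius strip. With \<open>R = y \<otimes> z\<close>, the relation is \<open>x R\<^sup>m x = R\<^sup>m y\<close> for \<open>m = k / 2\<close>.
\<close>

definition moebius_regular ::
    "('a, 'b) monoid_scheme \<Rightarrow> nat \<Rightarrow> nat \<Rightarrow> 'a \<Rightarrow> 'a \<Rightarrow> 'a \<Rightarrow> bool" where
  "moebius_regular G k l x y z \<longleftrightarrow>
     regular_map G k l x y z \<and> even k \<and>
     x \<otimes>\<^bsub>G\<^esub> ((y \<otimes>\<^bsub>G\<^esub> z) [^]\<^bsub>G\<^esub> (k div 2)) \<otimes>\<^bsub>G\<^esub> x
       = ((y \<otimes>\<^bsub>G\<^esub> z) [^]\<^bsub>G\<^esub> (k div 2)) \<otimes>\<^bsub>G\<^esub> y"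

text \<open>
  Finite fields are subfields \<open>F\<close> of an ambient field type, so the linear groups
  take the coefficient field as a set argument.
\<close>

definition GL2 :: "'a::field set \<Rightarrow> ('a^2^2) monoid" where
  "GL2 F = \<lparr>carrier = {A. (\<forall>i j. A $ i $ j \<in> F) \<and> det A \<noteq> 0},
            monoid.mult = (**), one = mat 1\<rparr>"

definition SL2 :: "'a::field set \<Rightarrow> ('a^2^2) monoid" where
  "SL2 F = GL2 F \<lparr>carrier := {A \<in> carrier (GL2 F). det A = 1}\<rparr>"

definition scalars2 :: "'a::field set \<Rightarrow> ('a^2^2) set" where
  "scalars2 F = mat ` (F - {0})"

definition PGL2 :: "'a::field set \<Rightarrow> ('a^2^2) set monoid" where
  "PGL2 F = GL2 F Mod scalars2 F"

definition PSL2 :: "'a::field set \<Rightarrow> ('a^2^2) set monoid" where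
  "PSL2 F = SL2 F Mod (scalars2 F \<inter> carrier (SL2 F))"

definition pgl_class :: "'a::field^2^2 \<Rightarrow> ('a^2^2) set" where
  "pgl_class A = scalars2 UNIV #>\<^bsub>GL2 UNIV\<^esub> A"

definition scaled_mat2 :: "'a::field \<Rightarrow> 'a \<Rightarrow> 'a \<Rightarrow> 'a \<Rightarrow> 'a \<Rightarrow> 'a^2^2" where
  "scaled_mat2 s a b c d = map_matrix ((*) s) (vector [vector [a, b], vector [c, d]])"

definition primitive_root_of_unity :: "nat \<Rightarrow> 'a::field \<Rightarrow> bool" where
  "primitive_root_of_unity n a \<longleftrightarrow> n > 0 \<and> a ^ n = 1 \<and> (\<forall>m. 0 < m \<and> m < n \<longrightarrow> a ^ m \<noteq> 1)"

text \<open>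
  For a prime power \<open>n\<close> and an algebraically closed ambient field of the right
  characteristic there is exactly one such \<open>F\<close>, namely \<open>GF(n)\<close>.
\<close>

definition is_subfield_of_order :: "'a::field set \<Rightarrow> nat \<Rightarrow> bool" where
  "is_subfield_of_order F n \<longleftrightarrow> subfield F (ring_of_type_algebra :: 'a ring) \<and> card F = n"

end

theory Submission
  imports Defs
begin

text \<open>
  Projectively, \<open>R = Y Z\<close> is \<open>diag(\<xi>\<^sub>k, 1 / \<xi>\<^sub>k)\<close>, and \<open>Z X\<close> has a representative of determinant 1
  and trace \<open>\<omega>\<^sub>l\<close>; so the map has type \<open>(k, l)\<close>. As \<open>\<xi>\<^sub>k\<^sup>k = -1\<close>, for even \<open>k\<close> the power \<open>R\<^bsup>k/2\<^esup>\<close> is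
  \<open>diag(1, -1)\<close> up to a scalar. Then \<open>X R\<^bsup>k/2\<^esup> X\<close> has diagonal entries \<open>\<plusminus> D (D + \<omega>\<^sub>l\<^sup>2)\<close> and its off-diagonal
  part is \<open>2 D \<omega>\<^sub>l\<close> times the antidiagonal matrix \<open>R\<^bsup>k/2\<^esup> Y\<close>, so the Moebius relation amounts to \<open>D + \<omega>\<^sub>l\<^sup>2 = 0\<close>.
\<close>

section \<open>Roots of unity and orders of group elements\<close>

lemma primitive_root_pow_eq_1_iff:
  assumes "primitive_root_of_unity n a"
  shows "a ^ m = 1 \<longleftrightarrow> n dvd m"
proof -
  have n: "n > 0" "a ^ n = 1" and least: "\<And>i. 0 < i \<Longrightarrow> i < n \<Longrightarrow> a ^ i \<noteq> 1"
    using assms by (auto simp: primitive_root_of_unity_def)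
  have "a ^ m = (a ^ n) ^ (m div n) * a ^ (m mod n)"
    by (metis mult_div_mod_eq power_add power_mult)
  then have "a ^ m = a ^ (m mod n)"
    using n by simp
  moreover have "a ^ (m mod n) = 1 \<longleftrightarrow> m mod n = 0"
    using least[of "m mod n"] n by (cases "m mod n = 0") auto
  ultimately show ?thesis
    by (simp add: dvd_eq_mod_eq_0)
qed

lemma primitive_root_nonzero: "primitive_root_of_unity n a \<Longrightarrow> a \<noteq> 0"
  by (auto simp: primitive_root_of_unity_def power_0_left)

text \<open>\<open>a ^ n\<close> is a square root of 1, and it is not 1 because \<open>n\<close>
  lies strictly below the order \<open>2 * n\<close>; a field leaves only -1.\<close>

lemma primitive_root_half_power:
  assumes "primitive_root_of_unity (2 * n) (a :: 'a::field)"
  shows "a ^ n = - 1"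
proof -
  have "(a ^ n)\<^sup>2 = 1" "a ^ n \<noteq> 1"
    using assms by (auto simp: primitive_root_of_unity_def power_mult[symmetric] mult.commute)
  then show ?thesis
    by (simp add: power2_eq_1_iff)
qed

text \<open>Powers and the identity are those of the ambient group. This lets all orders for the map
  be computed in PGL(2,K) by explicit matrices and then be moved to \<open>G\<close>.\<close>

lemma (in group) ord_subgroup_generated:
  assumes "S \<subseteq> carrier G" "a \<in> generate G S"
  shows "group.ord (subgroup_generated G S) a = ord a"
proof -
  interpret H: group "subgroup_generated G S"
    by simp
  have a: "a \<in> carrier (subgroup_generated G S)" "a \<in> carrier G"
    using assms generate_incl by (auto simp: carrier_subgroup_generated Int_absorb1)
  then show ?thesis
    by (simp add: H.ord_unique[OF a(1)] pow_subgroup_generated pow_eq_id)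
qed

lemma (in group) ord_eq_2I:
  assumes "a \<in> carrier G" "a \<otimes> a = \<one>" "a \<noteq> \<one>"
  shows "ord a = 2"
proof -
  have "a [^] (2::nat) = \<one>"
    using assms by (simp add: numeral_2_eq_2)
  then have "ord a dvd 2"
    using assms by (simp add: pow_eq_id)
  then have "ord a \<le> 2" "ord a \<noteq> 0"
    by (auto dest: dvd_imp_le intro: gr0I)
  moreover have "ord a \<noteq> 1"
    using assms ord_eq_1 by blast
  ultimately show ?thesis
    by linarith
qed

section \<open>Entrywise calculation with 2 by 2 matrices, and GL(2,K)\<close>

definition mat2 :: "'a::field \<Rightarrow> 'a \<Rightarrow> 'a \<Rightarrow> 'a \<Rightarrow> 'a^2^2" where
  "mat2 a b c d = vector [vector [a, b], vector [c, d]]"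

lemma mat2_eq_iff: "mat2 a b c d = mat2 a' b' c' d' \<longleftrightarrow> a = a' \<and> b = b' \<and> c = c' \<and> d = d'"
  by (auto simp: mat2_def vec_eq_iff forall_2)

lemma det_mat2: "det (mat2 a b c d) = a * d - b * c"
  by (simp add: mat2_def det_2)

lemma mat2_mult:
  "mat2 a b c d ** mat2 a' b' c' d'
     = mat2 (a * a' + b * c') (a * b' + b * d') (c * a' + d * c') (c * b' + d * d')"
  by (simp add: mat2_def matrix_matrix_mult_def vec_eq_iff forall_2 sum_2)

lemma mat_eq_mat2: "mat s = mat2 s 0 0 s"
  by (simp add: mat2_def mat_def vec_eq_iff forall_2)

lemma scaled_mat2_eq: "scaled_mat2 s a b c d = mat2 (s * a) (s * b) (s * c) (s * d)"
  by (simp add: mat2_def scaled_mat2_def map_matrix_def vec_eq_iff forall_2)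

lemma mat2_cases:
  obtains a b c d where "A = mat2 a b c d"
  by (rule that[of "A $ 1 $ 1" "A $ 1 $ 2" "A $ 2 $ 1" "A $ 2 $ 2"])
    (simp add: mat2_def vec_eq_iff forall_2)

lemma group_GL2: "group (GL2 (UNIV :: 'a::field set))"
proof (rule groupI, goal_cases)
  case (5 A)
  then have "invertible A"
    by (simp add: GL2_def invertible_det_nz)
  then obtain B where "A ** B = mat 1" "B ** A = mat 1"
    by (auto simp: invertible_def)
  moreover from this have "det B \<noteq> 0"
    by (metis invertible_def invertible_det_nz)
  ultimately show ?case
    by (auto simp: GL2_def)
qed (auto simp: GL2_def det_mul matrix_mul_assoc)

text \<open>Scalar matrices are central, so their left and right cosets agree.\<close>

lemma scalars2_normal: "scalars2 UNIV \<lhd> GL2 (UNIV :: 'a::field set)"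
proof -
  interpret group "GL2 (UNIV :: 'a set)"
    by (rule group_GL2)
  have comm: "mat s ** A = A ** mat s" for s and A :: "'a^2^2"
    by (cases A rule: mat2_cases) (simp add: mat_eq_mat2 mat2_mult mult.commute)
  have "subgroup (scalars2 UNIV) (GL2 (UNIV :: 'a set))"
  proof (rule subgroupI, goal_cases)
    case (3 A)
    then obtain s where s: "s \<noteq> 0" "A = mat s"
      by (auto simp: scalars2_def)
    have "inv\<^bsub>GL2 UNIV\<^esub> A = mat (inverse s)"
      using s by (intro inv_equality) (auto simp: GL2_def mat_eq_mat2 mat2_mult det_mat2)
    then show ?case
      using s by (auto simp: scalars2_def)
  next
    case (4 A B)
    then obtain s t where "s \<noteq> 0" "A = mat s" "t \<noteq> 0" "B = mat t"
      by (auto simp: scalars2_def)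
    moreover have "mat s ** mat t = (mat (s * t) :: 'a^2^2)"
      by (simp add: mat_eq_mat2 mat2_mult)
    ultimately show ?case
      by (auto simp: GL2_def scalars2_def)
  next
    case 2
    have "(1 :: 'a) \<in> UNIV - {0}"
      by simp
    then show ?case
      unfolding scalars2_def by blast
  next
    case 1
    show ?case
      by (auto simp: scalars2_def GL2_def mat_eq_mat2 det_mat2)
  qed
  then show ?thesis
    unfolding normal_def normal_axioms_def
    using group_axioms comm by (simp add: r_coset_def l_coset_def) (auto simp: GL2_def scalars2_def)
qed

section \<open>Calculation in PGL(2,K) with matrix representatives\<close>

definition pgl_mat :: "'a::field \<Rightarrow> 'a \<Rightarrow> 'a \<Rightarrow> 'a \<Rightarrow> ('a^2^2) set" where
  "pgl_mat a b c d = pgl_class (mat2 a b c d)"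

lemma group_PGL2: "group (PGL2 (UNIV :: 'a::field set))"
  unfolding PGL2_def by (intro normal.factorgroup_is_group scalars2_normal)

lemma pgl_mat_in_carrier:
  "a * d - b * c \<noteq> 0 \<Longrightarrow> pgl_mat a b c d \<in> carrier (PGL2 UNIV)"
  by (auto simp: PGL2_def carrier_FactGroup pgl_mat_def pgl_class_def GL2_def det_mat2)

lemma one_PGL2: "\<one>\<^bsub>PGL2 UNIV\<^esub> = pgl_mat 1 0 0 (1 :: 'a::field)"
proof -
  interpret normal "scalars2 UNIV" "GL2 (UNIV :: 'a set)"
    by (rule scalars2_normal)
  have "mat2 1 0 0 (1 :: 'a) = \<one>\<^bsub>GL2 UNIV\<^esub>"
    by (simp add: GL2_def mat_eq_mat2)
  then show ?thesis
    using coset_mult_one[OF subset] by (simp add: PGL2_def pgl_mat_def pgl_class_def)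
qed

lemma pgl_mat_mult:
  assumes "a * d - b * c \<noteq> 0" "a' * d' - b' * c' \<noteq> 0"
  shows "pgl_mat a b c d \<otimes>\<^bsub>PGL2 UNIV\<^esub> pgl_mat a' b' c' d'
     = pgl_mat (a * a' + b * c') (a * b' + b * d') (c * a' + d * c') (c * b' + d * d')"
proof -
  interpret normal "scalars2 UNIV" "GL2 UNIV"
    by (rule scalars2_normal)
  have "mat2 a b c d \<in> carrier (GL2 UNIV)" "mat2 a' b' c' d' \<in> carrier (GL2 UNIV)"
    using assms by (auto simp: GL2_def det_mat2)
  from rcos_sum[OF this] show ?thesis
    by (simp add: PGL2_def pgl_mat_def pgl_class_def GL2_def mat2_mult)
qed

text \<open>Two cosets agree as soon as a representative of one lies in the other. Equality of
  projective classes thereby becomes four equations in K with one unknown scalar.\<close>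

lemma pgl_mat_eq_iff:
  assumes "a * d - b * c \<noteq> 0" "a' * d' - b' * c' \<noteq> 0"
  shows "pgl_mat a b c d = pgl_mat a' b' c' d'
    \<longleftrightarrow> (\<exists>s. s \<noteq> 0 \<and> a = s * a' \<and> b = s * b' \<and> c = s * c' \<and> d = s * d')"
proof -
  interpret normal "scalars2 UNIV" "GL2 UNIV"
    by (rule scalars2_normal)
  have carrier: "mat2 a b c d \<in> carrier (GL2 UNIV)" "mat2 a' b' c' d' \<in> carrier (GL2 UNIV)"
    using assms by (auto simp: GL2_def det_mat2)
  have "pgl_mat a b c d = pgl_mat a' b' c' d' \<longleftrightarrow> mat2 a b c d \<in> pgl_mat a' b' c' d'"
    unfolding pgl_mat_def pgl_class_def
    using carrier rcos_self[OF _ is_subgroup] repr_independence[OF _ _ is_subgroup] by metis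
  also have "\<dots> \<longleftrightarrow> (\<exists>s. s \<noteq> 0 \<and> mat2 a b c d = mat s ** mat2 a' b' c' d')"
    by (auto simp: pgl_mat_def pgl_class_def r_coset_def scalars2_def GL2_def)
  finally show ?thesis
    by (simp add: mat_eq_mat2 mat2_mult mat2_eq_iff)
qed

lemma pgl_mat_scale:
  assumes "s \<noteq> 0" "a * d - b * c \<noteq> 0"
  shows "pgl_mat (s * a) (s * b) (s * c) (s * d) = pgl_mat a b c d"
proof -
  have "(s * a) * (s * d) - (s * b) * (s * c) = s * s * (a * d - b * c)"
    by (simp add: algebra_simps)
  then show ?thesis
    using assms by (subst pgl_mat_eq_iff) auto
qed

lemma pgl_mat_eq_one_iff:
  assumes "a * d - b * c \<noteq> 0"
  shows "pgl_mat a b c d = \<one>\<^bsub>PGL2 UNIV\<^esub> \<longleftrightarrow> a = d \<and> b = 0 \<and> c = 0"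
  using assms by (auto simp: one_PGL2 pgl_mat_eq_iff)

text \<open>This strips the factors \<open>\<beta>\<close> and \<open>\<eta> * \<beta>\<close> from
  the three generators once they are known to be nonzero.\<close>

lemma pgl_class_scaled_mat2:
  assumes "s \<noteq> 0" "a * d - b * c \<noteq> 0"
  shows "pgl_class (scaled_mat2 s a b c d) = pgl_mat a b c d"
  using pgl_mat_scale[OF assms] by (simp add: scaled_mat2_eq pgl_mat_def)

section \<open>Orders of elements of PGL(2,K)\<close>

lemma pgl_mat_traceless_ord:
  assumes det: "a * - a - b * c \<noteq> 0" and "a \<noteq> - a \<or> b \<noteq> 0 \<or> c \<noteq> 0"
  shows "group.ord (PGL2 UNIV) (pgl_mat a b c (- a)) = 2"
proof -
  interpret group "PGL2 UNIV"
    by (rule group_PGL2)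
  \<comment> \<open>A traceless matrix squares to minus its determinant times the identity. The
    determinant of the square is recorded because \<open>pgl_mat_eq_one_iff\<close> asks for it to
    be nonzero. The second assumption says that the matrix itself is not scalar, so its class is not
    the identity.\<close>
  have sq: "(a * a + b * c) * (c * b + - a * - a) - (a * b + b * - a) * (c * a + - a * c)
      = (a * - a - b * c)\<^sup>2"
    by (simp add: power2_eq_square algebra_simps)
  have "pgl_mat a b c (- a) \<otimes>\<^bsub>PGL2 UNIV\<^esub> pgl_mat a b c (- a) = \<one>\<^bsub>PGL2 UNIV\<^esub>"
    unfolding pgl_mat_mult[OF det det] using det sq
    by (subst pgl_mat_eq_one_iff) (simp_all add: mult.commute)
  then show ?thesis
    using det assms by (intro ord_eq_2I) (auto simp: pgl_mat_in_carrier pgl_mat_eq_one_iff)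
qed

lemma pgl_mat_diag_pow:
  assumes "a \<noteq> 0" "d \<noteq> 0"
  shows "pgl_mat a 0 0 d [^]\<^bsub>PGL2 UNIV\<^esub> (n::nat) = pgl_mat (a ^ n) 0 0 (d ^ n)"
proof (induction n)
  case 0
  show ?case
    by (simp add: one_PGL2)
next
  case (Suc n)
  then show ?case
    using assms by (simp add: pgl_mat_mult mult.commute)
qed

text \<open>
  By Cayley-Hamilton, \<open>(u - v) M\<^sup>n = (u\<^sup>n - v\<^sup>n) M - (u\<^sup>n v - v\<^sup>n u)\<close>
  if \<open>u\<close> and \<open>v = 1 / u\<close> are the eigenvalues of \<open>M\<close>.
\<close>

lemma pgl_mat_pow:
  fixes a b c d u v :: "'a::field" and n :: nat
  assumes "u * v = 1" "u \<noteq> v" "a + d = u + v" "a * d - b * c = 1"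
  defines "s \<equiv> u ^ n - v ^ n" and "t \<equiv> u ^ n * v - v ^ n * u"
  shows "pgl_mat a b c d [^]\<^bsub>PGL2 UNIV\<^esub> n = pgl_mat (s * a - t) (s * b) (s * c) (s * d - t)"
    and "(s * a - t) * (s * d - t) - (s * b) * (s * c) \<noteq> 0"
proof -
  let ?s = "\<lambda>n. u ^ n - v ^ n" and ?t = "\<lambda>n. u ^ n * v - v ^ n * u"
  have det: "(?s n * a - ?t n) * (?s n * d - ?t n) - (?s n * b) * (?s n * c) \<noteq> 0" for n
  proof -
    have "(?s n * a - ?t n) * (?s n * d - ?t n) - (?s n * b) * (?s n * c)
        = ?s n * ?s n * (a * d - b * c) - ?s n * ?t n * (a + d) + ?t n * ?t n"
      by (simp add: algebra_simps)
    also have "\<dots> = ?s n * ?s n * (u * v) - ?s n * ?t n * (u + v) + ?t n * ?t n"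
      using assms by simp
    \<comment> \<open>The quadratic form factors as \<open>(s u - t) (s v - t)\<close>, with
      \<open>s u - t = u^n (u - v)\<close> and \<open>s v - t = v^n (u - v)\<close>.\<close>
    also have "\<dots> = (u * v) ^ n * (u - v)\<^sup>2"
      unfolding power_mult_distrib power2_eq_square by (simp only: algebra_simps)
    finally show ?thesis
      using assms by simp
  qed
  then show "(s * a - t) * (s * d - t) - (s * b) * (s * c) \<noteq> 0"
    unfolding s_def t_def .
  have "pgl_mat a b c d [^]\<^bsub>PGL2 UNIV\<^esub> n
      = pgl_mat (?s n * a - ?t n) (?s n * b) (?s n * c) (?s n * d - ?t n)"
  proof (induction n)
    case 0
    \<comment> \<open>For exponent 0, \<open>s = 0\<close> and \<open>t = v - u\<close>, so the
      claimed matrix is the scalar \<open>u - v\<close>.\<close>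
    have "pgl_mat (u - v) 0 0 (u - v) = \<one>\<^bsub>PGL2 UNIV\<^esub>"
      using \<open>u \<noteq> v\<close> by (subst pgl_mat_eq_one_iff) auto
    then show ?case
      by simp
  next
    case (Suc n)
    \<comment> \<open>For M with entries a, b, c, d, Cayley-Hamilton turns
      \<open>(s M - t) M\<close> into \<open>(s (a + d) - t) M - s (a d - b c)\<close>; the next two
      facts identify these coefficients with those for \<open>Suc n\<close>.\<close>
    have s: "?s (Suc n) = ?s n * (a + d) - ?t n"
      using assms by (simp add: algebra_simps)
    have t: "?t (Suc n) = ?s n * (a * d - b * c)"
    proof -
      have "?t (Suc n) = ?s n * (u * v)"
        by (simp add: algebra_simps)
      then show ?thesis
        using assms by simp
    qed
    have "a * d - b * c \<noteq> 0"
      using assms by simp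
    then have "pgl_mat a b c d [^]\<^bsub>PGL2 UNIV\<^esub> Suc n
        = pgl_mat ((?s n * a - ?t n) * a + ?s n * b * c) ((?s n * a - ?t n) * b + ?s n * b * d)
            (?s n * c * a + (?s n * d - ?t n) * c) (?s n * c * b + (?s n * d - ?t n) * d)"
      by (simp add: Suc.IH pgl_mat_mult[OF det])
    also have "\<dots> = pgl_mat (?s (Suc n) * a - ?t (Suc n)) (?s (Suc n) * b)
        (?s (Suc n) * c) (?s (Suc n) * d - ?t (Suc n))"
      unfolding s t by (simp add: algebra_simps)
    finally show ?case .
  qed
  then show "pgl_mat a b c d [^]\<^bsub>PGL2 UNIV\<^esub> n
      = pgl_mat (s * a - t) (s * b) (s * c) (s * d - t)"
    unfolding s_def t_def .
qed

text \<open>The eigenvalues are u and its inverse, and \<open>n \<ge> 2\<close> makes them distinct,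
  so \<open>pgl_mat_pow\<close> applies. As the matrix is not scalar, its m-th power is scalar
  exactly when the coefficient \<open>u^m - u^(-m)\<close> vanishes, that is when
  \<open>u^(2 m) = 1\<close>, that is when n divides m.\<close>

lemma pgl_mat_ord:
  fixes a b c d u :: "'a::field"
  assumes prim: "primitive_root_of_unity (2 * n) u" and "n \<ge> 2"
    and "a + d = u + inverse u" "a * d - b * c = 1" "a \<noteq> d \<or> b \<noteq> 0 \<or> c \<noteq> 0"
  shows "group.ord (PGL2 UNIV) (pgl_mat a b c d) = n"
proof -
  interpret group "PGL2 (UNIV :: 'a set)"
    by (rule group_PGL2)
  have u: "u * inverse u = 1"
    using primitive_root_nonzero[OF prim] by simp
  have eq_iff: "u ^ m = inverse u ^ m \<longleftrightarrow> n dvd m" for m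
  proof -
    have "u ^ m * inverse u ^ m = 1"
      using u by (metis power_mult_distrib power_one)
    then have "u ^ m = inverse u ^ m \<longleftrightarrow> u ^ (2 * m) = 1"
      unfolding mult_2 power_add by (metis mult_left_cancel mult_zero_left zero_neq_one)
    then show ?thesis
      by (simp add: primitive_root_pow_eq_1_iff[OF prim])
  qed
  have "u \<noteq> inverse u"
    using eq_iff[of 1] \<open>n \<ge> 2\<close> by auto
  note pow = pgl_mat_pow[OF u this assms(3,4)]
  have "pgl_mat a b c d [^]\<^bsub>PGL2 UNIV\<^esub> m = \<one>\<^bsub>PGL2 UNIV\<^esub> \<longleftrightarrow> n dvd m" for m
    unfolding pow(1) pgl_mat_eq_one_iff[OF pow(2)] eq_iff[symmetric]
    using assms(5) by auto
  then show ?thesis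
    using assms(4) by (subst ord_unique) (auto simp: pgl_mat_in_carrier)
qed

theorem proposition4p4:
  fixes p e q k l :: nat
    and Fp Fq Fqq :: "'K::field set"
    and \<xi>\<^sub>k \<xi>\<^sub>l \<omega>\<^sub>k \<omega>\<^sub>l D r \<beta> \<eta> :: 'K
    and x y z :: "('K^2^2) set"
    and G :: "('K^2^2) set monoid"
  assumes "Factorial_Ring.prime p" and "odd p" and "e \<ge> 1" and "q = p ^ e"
    and "k \<ge> 3" and "l \<ge> 3" and "coprime k p" and "coprime l p"
    and "1 / real k + 1 / real l < 1 / 2"
    and "is_subfield_of_order Fp p"
    and "algebraic_closure (ring_of_type_algebra :: 'K ring) Fp"
    and "is_subfield_of_order Fq q" and "is_subfield_of_order Fqq (q\<^sup>2)"
    and "primitive_root_of_unity (2 * k) \<xi>\<^sub>k" and "\<xi>\<^sub>k \<in> Fq \<union> Fqq"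
    and "primitive_root_of_unity (2 * l) \<xi>\<^sub>l" and "\<xi>\<^sub>l \<in> Fq \<union> Fqq"
    and "\<omega>\<^sub>k = \<xi>\<^sub>k + inverse \<xi>\<^sub>k" and "\<omega>\<^sub>l = \<xi>\<^sub>l + inverse \<xi>\<^sub>l"
    and "D = \<omega>\<^sub>k\<^sup>2 + \<omega>\<^sub>l\<^sup>2 - 4" and "D \<noteq> 0"
    and "r\<^sup>2 = - D" and "\<beta> = - 1 / r"
    and "\<eta> = inverse (\<xi>\<^sub>k - inverse \<xi>\<^sub>k)"
    and "x = pgl_class (scaled_mat2 (\<eta> * \<beta>) D (D * \<omega>\<^sub>l * \<xi>\<^sub>k) (- \<omega>\<^sub>l * inverse \<xi>\<^sub>k) (- D))"
    and "y = pgl_class (scaled_mat2 \<beta> 0 (\<xi>\<^sub>k * D) (inverse \<xi>\<^sub>k) 0)"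
    and "z = pgl_class (scaled_mat2 \<beta> 0 D 1 0)"
    and "G = subgroup_generated (PGL2 (UNIV :: 'K set)) {x, y, z}"
    and "G \<cong> PSL2 Fq \<or> G \<cong> PGL2 Fq"
  shows "moebius_regular G k l x y z \<longleftrightarrow> even k \<and> \<omega>\<^sub>k\<^sup>2 + 2 * \<omega>\<^sub>l\<^sup>2 = 4"
proof -

  \<comment> \<open>The generators as classes of explicit matrices\<close>
  interpret P: group "PGL2 (UNIV :: 'K set)"
    by (rule group_PGL2)
  note prim_k = \<open>primitive_root_of_unity (2 * k) \<xi>\<^sub>k\<close>
  note prim_l = \<open>primitive_root_of_unity (2 * l) \<xi>\<^sub>l\<close>
  define v where "v = inverse \<xi>\<^sub>k"
  have pow_k: "\<xi>\<^sub>k ^ k = - 1"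
    by (rule primitive_root_half_power[OF prim_k])
  \<comment> \<open>If 1 and -1 were equal, \<open>\<xi>\<^sub>k ^ k\<close> would be 1, although
    \<open>2 * k\<close> does not divide \<open>k\<close>.\<close>
  have "(1 :: 'K) \<noteq> - 1"
    using pow_k primitive_root_pow_eq_1_iff[OF prim_k, of k] \<open>k \<ge> 3\<close> by (auto dest: dvd_imp_le)
  then have two: "(2 :: 'K) \<noteq> 0"
    by (metis add_eq_0_iff one_add_one)
  have "\<xi>\<^sub>k \<noteq> 0"
    by (rule primitive_root_nonzero[OF prim_k])
  then have uv: "\<xi>\<^sub>k * v = 1"
    by (simp add: v_def)
  have "\<xi>\<^sub>k\<^sup>2 \<noteq> 1"
    using \<open>k \<ge> 3\<close> primitive_root_pow_eq_1_iff[OF prim_k, of 2] by (auto dest: dvd_imp_le)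
  then have "\<xi>\<^sub>k \<noteq> v"
    using uv by (auto simp: power2_eq_square)
  then have \<eta>: "\<eta> * (\<xi>\<^sub>k - v) = 1" "\<eta> \<noteq> 0"
    using assms(24) by (auto simp: v_def)
  have "r \<noteq> 0"
    using \<open>r\<^sup>2 = - D\<close> \<open>D \<noteq> 0\<close> by auto
  then have \<beta>: "\<beta> \<noteq> 0"
    using \<open>\<beta> = - 1 / r\<close> by simp
  have "(\<xi>\<^sub>k + v)\<^sup>2 - 4 * (\<xi>\<^sub>k * v) = (\<xi>\<^sub>k - v)\<^sup>2"
    by (simp add: power2_eq_square algebra_simps)
  \<comment> \<open>The determinants of the representatives of \<open>x\<close>, of
    \<open>x y\<close> and of \<open>x h x\<close> below all have
    \<open>D - \<omega>\<^sub>l\<^sup>2\<close> as a factor; writing it as a square of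
    \<open>\<xi>\<^sub>k - v\<close> shows that it is nonzero.\<close>
  then have D_eq: "D - \<omega>\<^sub>l\<^sup>2 = (\<xi>\<^sub>k - v)\<^sup>2"
    using uv assms(18,20) by (simp add: v_def)
  have detX: "D * - D - (D * \<omega>\<^sub>l * \<xi>\<^sub>k) * (- \<omega>\<^sub>l * v) = - D * (\<xi>\<^sub>k - v)\<^sup>2"
  proof -
    have "D * - D - (D * \<omega>\<^sub>l * \<xi>\<^sub>k) * (- \<omega>\<^sub>l * v) = - D * (D - \<omega>\<^sub>l\<^sup>2 * (\<xi>\<^sub>k * v))"
      by (simp add: power2_eq_square algebra_simps)
    then show ?thesis
      using uv D_eq by simp
  qed
  have detX_nz: "D * - D - (D * \<omega>\<^sub>l * \<xi>\<^sub>k) * (- \<omega>\<^sub>l * v) \<noteq> 0"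
    unfolding detX using \<open>D \<noteq> 0\<close> \<open>\<xi>\<^sub>k \<noteq> v\<close> by simp
  have nz: "\<xi>\<^sub>k \<noteq> 0" "v \<noteq> 0" "D \<noteq> 0" "\<xi>\<^sub>k - v \<noteq> 0"
    using uv \<open>D \<noteq> 0\<close> \<open>\<xi>\<^sub>k \<noteq> v\<close> by auto
  have x: "x = pgl_mat D (D * \<omega>\<^sub>l * \<xi>\<^sub>k) (- \<omega>\<^sub>l * v) (- D)"
    using assms(25) \<beta> \<eta> detX_nz by (simp only: pgl_class_scaled_mat2 v_def[symmetric] mult_eq_0_iff simp_thms)
  have y: "y = pgl_mat 0 (\<xi>\<^sub>k * D) v 0"
    using assms(26) \<beta> nz by (simp add: pgl_class_scaled_mat2 v_def)
  have z: "z = pgl_mat 0 D 1 0"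
    using assms(27) \<beta> nz by (simp add: pgl_class_scaled_mat2)
  have x_carrier: "x \<in> carrier (PGL2 UNIV)"
    unfolding x by (rule pgl_mat_in_carrier[OF detX_nz])
  have y_carrier: "y \<in> carrier (PGL2 UNIV)" and z_carrier: "z \<in> carrier (PGL2 UNIV)"
    using nz by (auto simp: y z pgl_mat_in_carrier)
  note carrier = x_carrier y_carrier z_carrier

  \<comment> \<open>The products of pairs of generators\<close>
  have xy: "x \<otimes>\<^bsub>PGL2 UNIV\<^esub> y = pgl_mat \<omega>\<^sub>l (\<xi>\<^sub>k * D) (- v) (- \<omega>\<^sub>l)"
  proof -
    \<comment> \<open>Every entry of the product carries a factor D, put in front so that
      \<open>pgl_mat_scale\<close> can drop it.\<close>
    have "x \<otimes>\<^bsub>PGL2 UNIV\<^esub> y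
        = pgl_mat (D * (\<omega>\<^sub>l * (\<xi>\<^sub>k * v))) (D * (\<xi>\<^sub>k * D)) (D * - v) (D * (- \<omega>\<^sub>l * (\<xi>\<^sub>k * v)))"
      unfolding x y using nz by (subst pgl_mat_mult[OF detX_nz]) (auto simp: algebra_simps)
    also have "\<dots> = pgl_mat (\<omega>\<^sub>l * (\<xi>\<^sub>k * v)) (\<xi>\<^sub>k * D) (- v) (- \<omega>\<^sub>l * (\<xi>\<^sub>k * v))"
    proof (rule pgl_mat_scale)
      have "\<omega>\<^sub>l * (\<xi>\<^sub>k * v) * (- \<omega>\<^sub>l * (\<xi>\<^sub>k * v)) - \<xi>\<^sub>k * D * - v = D - \<omega>\<^sub>l\<^sup>2"
        using uv by (simp add: power2_eq_square algebra_simps)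
      then show "\<omega>\<^sub>l * (\<xi>\<^sub>k * v) * (- \<omega>\<^sub>l * (\<xi>\<^sub>k * v)) - \<xi>\<^sub>k * D * - v \<noteq> 0"
        using D_eq nz by simp
    qed (rule nz)
    finally show ?thesis
      using uv by simp
  qed
  have yz: "y \<otimes>\<^bsub>PGL2 UNIV\<^esub> z = pgl_mat \<xi>\<^sub>k 0 0 v"
  proof -
    have "y \<otimes>\<^bsub>PGL2 UNIV\<^esub> z = pgl_mat (D * \<xi>\<^sub>k) (D * 0) (D * 0) (D * v)"
      unfolding y z using nz by (subst pgl_mat_mult) (auto simp: algebra_simps)
    also have "\<dots> = pgl_mat \<xi>\<^sub>k 0 0 v"
      using nz by (intro pgl_mat_scale) auto
    finally show ?thesis .
  qed
  \<comment> \<open>The scaling by \<open>\<eta>\<close> is chosen to give this representative of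
    \<open>z x\<close> determinant 1 and trace \<open>\<omega>\<^sub>l\<close>, the form that
    \<open>pgl_mat_ord\<close> takes.\<close>
  have det_zx: "(\<eta> * (- \<omega>\<^sub>l * v)) * (\<eta> * (\<omega>\<^sub>l * \<xi>\<^sub>k)) - (\<eta> * - D) * \<eta> = 1"
  proof -
    have "(\<eta> * (- \<omega>\<^sub>l * v)) * (\<eta> * (\<omega>\<^sub>l * \<xi>\<^sub>k)) - (\<eta> * - D) * \<eta> = \<eta>\<^sup>2 * (D - \<omega>\<^sub>l\<^sup>2 * (\<xi>\<^sub>k * v))"
      by (simp add: power2_eq_square algebra_simps)
    also have "\<dots> = (\<eta> * (\<xi>\<^sub>k - v))\<^sup>2"
      by (simp add: uv D_eq power_mult_distrib)
    finally show ?thesis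
      by (simp add: \<eta>)
  qed
  have zx: "z \<otimes>\<^bsub>PGL2 UNIV\<^esub> x
      = pgl_mat (\<eta> * (- \<omega>\<^sub>l * v)) (\<eta> * - D) \<eta> (\<eta> * (\<omega>\<^sub>l * \<xi>\<^sub>k))"
  proof -
    have "z \<otimes>\<^bsub>PGL2 UNIV\<^esub> x = pgl_mat (D * (- \<omega>\<^sub>l * v)) (D * - D) D (D * (\<omega>\<^sub>l * \<xi>\<^sub>k))"
      unfolding x z using nz by (subst pgl_mat_mult[OF _ detX_nz]) (auto simp: algebra_simps)
    also have "\<dots> = pgl_mat (D * (\<xi>\<^sub>k - v) * (\<eta> * (- \<omega>\<^sub>l * v))) (D * (\<xi>\<^sub>k - v) * (\<eta> * - D))
        (D * (\<xi>\<^sub>k - v) * \<eta>) (D * (\<xi>\<^sub>k - v) * (\<eta> * (\<omega>\<^sub>l * \<xi>\<^sub>k)))"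
    proof -
      \<comment> \<open>\<open>\<eta>\<close> is the inverse of \<open>\<xi>\<^sub>k - v\<close>, so
        inserting both changes no entry.\<close>
      have cancel: "D * (\<xi>\<^sub>k - v) * (\<eta> * a) = D * a" for a
      proof -
        have "D * (\<xi>\<^sub>k - v) * (\<eta> * a) = D * a * (\<eta> * (\<xi>\<^sub>k - v))"
          by (simp only: ac_simps)
        then show ?thesis
          by (simp only: \<eta>(1) mult_1_right)
      qed
      show ?thesis
        using cancel[of 1] by (simp only: cancel mult_1_right)
    qed
    also have "\<dots> = pgl_mat (\<eta> * (- \<omega>\<^sub>l * v)) (\<eta> * - D) \<eta> (\<eta> * (\<omega>\<^sub>l * \<xi>\<^sub>k))"
    proof (rule pgl_mat_scale)
      show "(\<eta> * (- \<omega>\<^sub>l * v)) * (\<eta> * (\<omega>\<^sub>l * \<xi>\<^sub>k)) - (\<eta> * - D) * \<eta> \<noteq> 0"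
        unfolding det_zx by simp
    qed (use nz in simp)
    finally show ?thesis .
  qed

  \<comment> \<open>The orders that make this a regular map of type (k,l)\<close>
  have "P.ord x = 2"
    unfolding x
  proof (rule pgl_mat_traceless_ord)
    show "D * - D - D * \<omega>\<^sub>l * \<xi>\<^sub>k * (- \<omega>\<^sub>l * v) \<noteq> 0"
      by (rule detX_nz)
    \<comment> \<open>If \<open>\<omega>\<^sub>l = 0\<close>, then \<open>x\<close> is the class of
      a diagonal matrix, and only \<open>D \<noteq> - D\<close> shows that it is not scalar.\<close>
    have "D + D \<noteq> 0"
      unfolding mult_2[symmetric] using nz two by simp
    then show "D \<noteq> - D \<or> D * \<omega>\<^sub>l * \<xi>\<^sub>k \<noteq> 0 \<or> - \<omega>\<^sub>l * v \<noteq> 0"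
      by (metis add.right_inverse)
  qed
  moreover have "P.ord y = 2"
    using pgl_mat_traceless_ord[of 0 "\<xi>\<^sub>k * D" v] nz by (simp add: y)
  moreover have "P.ord z = 2"
    using pgl_mat_traceless_ord[of 0 D 1] nz by (simp add: z)
  moreover have "P.ord (x \<otimes>\<^bsub>PGL2 UNIV\<^esub> y) = 2"
    unfolding xy
  proof (rule pgl_mat_traceless_ord)
    have "\<omega>\<^sub>l * - \<omega>\<^sub>l - \<xi>\<^sub>k * D * - v = D * (\<xi>\<^sub>k * v) - \<omega>\<^sub>l\<^sup>2"
      by (simp add: power2_eq_square algebra_simps)
    then show "\<omega>\<^sub>l * - \<omega>\<^sub>l - \<xi>\<^sub>k * D * - v \<noteq> 0"
      using uv D_eq nz by simp
  qed (use nz in auto)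
  moreover have "P.ord (y \<otimes>\<^bsub>PGL2 UNIV\<^esub> z) = k"
    unfolding yz using prim_k \<open>k \<ge> 3\<close> uv nz by (intro pgl_mat_ord) (auto simp: v_def)
  moreover have "P.ord (z \<otimes>\<^bsub>PGL2 UNIV\<^esub> x) = l"
    unfolding zx
  proof (rule pgl_mat_ord[OF prim_l])
    have "\<eta> * (- \<omega>\<^sub>l * v) + \<eta> * (\<omega>\<^sub>l * \<xi>\<^sub>k) = \<omega>\<^sub>l * (\<eta> * (\<xi>\<^sub>k - v))"
      by (simp add: algebra_simps)
    then show "\<eta> * (- \<omega>\<^sub>l * v) + \<eta> * (\<omega>\<^sub>l * \<xi>\<^sub>k) = \<xi>\<^sub>l + inverse \<xi>\<^sub>l"
      using \<eta> assms(19) by simp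
  qed (use det_zx \<open>l \<ge> 3\<close> \<eta> in auto)
  moreover have generators: "x \<in> carrier G" "y \<in> carrier G" "z \<in> carrier G"
    using carrier by (auto simp: \<open>G = _\<close> carrier_subgroup_generated intro: generate.incl)
  moreover have "group G"
    by (simp add: \<open>G = _\<close>)
  moreover have "group.ord G a = P.ord a" if "a \<in> carrier G" for a
    using that carrier P.ord_subgroup_generated[of "{x, y, z}" a]
    by (simp add: \<open>G = _\<close> carrier_subgroup_generated)
  moreover have "generate G {x, y, z} = carrier G"
    using generators P.subgroup_generated2[of "{x, y, z}"]
      carrier_subgroup_generated[of G "{x, y, z}"]
    by (simp add: \<open>G = _\<close>[symmetric])
  moreover have mult_G: "monoid.mult G = monoid.mult (PGL2 UNIV)"
    by (simp add: \<open>G = _\<close>)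
  ultimately have regular: "regular_map G k l x y z"
    unfolding regular_map_def regular_map_axioms_def
    by (metis group.is_monoid monoid.m_closed)

  \<comment> \<open>The Moebius relation\<close>
  have "x \<otimes>\<^bsub>G\<^esub> ((y \<otimes>\<^bsub>G\<^esub> z) [^]\<^bsub>G\<^esub> (k div 2)) \<otimes>\<^bsub>G\<^esub> x
       = ((y \<otimes>\<^bsub>G\<^esub> z) [^]\<^bsub>G\<^esub> (k div 2)) \<otimes>\<^bsub>G\<^esub> y
    \<longleftrightarrow> \<omega>\<^sub>k\<^sup>2 + 2 * \<omega>\<^sub>l\<^sup>2 = 4" if "even k"
  proof -
    define h where "h = (y \<otimes>\<^bsub>PGL2 UNIV\<^esub> z) [^]\<^bsub>PGL2 UNIV\<^esub> (k div 2)"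
    have pow_G: "(y \<otimes>\<^bsub>PGL2 UNIV\<^esub> z) [^]\<^bsub>G\<^esub> (k div 2) = h"
      by (simp add: h_def \<open>G = _\<close> pow_subgroup_generated)
    \<comment> \<open>\<open>i\<close> is a square root of -1, so its inverse
      \<open>v ^ (k div 2)\<close> equals \<open>- i\<close>, and \<open>h\<close> is
      \<open>i\<close> times diag(1, -1).\<close>
    define i where "i = \<xi>\<^sub>k ^ (k div 2)"
    have "i * i = - 1"
      using pow_k \<open>even k\<close> by (metis dvd_mult_div_cancel i_def mult_2 power_add)
    moreover have "i * v ^ (k div 2) = 1"
      using uv by (metis i_def power_mult_distrib power_one)
    ultimately have "v ^ (k div 2) = i * - 1" "i \<noteq> 0"
      by (metis minus_minus mult.assoc mult.commute mult_1 mult_minus_right, auto)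
    then have "h = pgl_mat (i * 1) (i * 0) (i * 0) (i * - 1)"
      using nz by (simp add: h_def yz pgl_mat_diag_pow i_def)
    also have "\<dots> = pgl_mat 1 0 0 (- 1)"
      using \<open>i \<noteq> 0\<close> by (intro pgl_mat_scale) auto
    finally have h: "h = pgl_mat 1 0 0 (- 1)" .
    have hy: "h \<otimes>\<^bsub>PGL2 UNIV\<^esub> y = pgl_mat 0 (\<xi>\<^sub>k * D) (- v) 0"
      using nz by (simp add: h y pgl_mat_mult)
    define a where "a = D * (D + \<omega>\<^sub>l\<^sup>2)"
    define s where "s = 2 * D * \<omega>\<^sub>l"
    have det_xh: "D * D - (- (D * \<omega>\<^sub>l * \<xi>\<^sub>k)) * (- \<omega>\<^sub>l * v) \<noteq> 0"
      using detX_nz by auto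
    have "x \<otimes>\<^bsub>PGL2 UNIV\<^esub> h = pgl_mat D (- (D * \<omega>\<^sub>l * \<xi>\<^sub>k)) (- \<omega>\<^sub>l * v) D"
      unfolding x h by (subst pgl_mat_mult[OF detX_nz]) auto
    then have "x \<otimes>\<^bsub>PGL2 UNIV\<^esub> h \<otimes>\<^bsub>PGL2 UNIV\<^esub> x
      = pgl_mat (D * D + (- (D * \<omega>\<^sub>l * \<xi>\<^sub>k)) * (- \<omega>\<^sub>l * v))
          (D * (D * \<omega>\<^sub>l * \<xi>\<^sub>k) + (- (D * \<omega>\<^sub>l * \<xi>\<^sub>k)) * - D)
          (- \<omega>\<^sub>l * v * D + D * (- \<omega>\<^sub>l * v))
          (- \<omega>\<^sub>l * v * (D * \<omega>\<^sub>l * \<xi>\<^sub>k) + D * - D)"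
      by (simp only: x pgl_mat_mult[OF det_xh detX_nz])
    moreover have "D * D + (- (D * \<omega>\<^sub>l * \<xi>\<^sub>k)) * (- \<omega>\<^sub>l * v) = D * (D + \<omega>\<^sub>l\<^sup>2 * (\<xi>\<^sub>k * v))"
      "D * (D * \<omega>\<^sub>l * \<xi>\<^sub>k) + (- (D * \<omega>\<^sub>l * \<xi>\<^sub>k)) * - D = s * (\<xi>\<^sub>k * D)"
      "- \<omega>\<^sub>l * v * D + D * (- \<omega>\<^sub>l * v) = s * - v"
      "- \<omega>\<^sub>l * v * (D * \<omega>\<^sub>l * \<xi>\<^sub>k) + D * - D = - (D * (D + \<omega>\<^sub>l\<^sup>2 * (\<xi>\<^sub>k * v)))"
      by (simp_all add: s_def power2_eq_square algebra_simps)
    ultimately have xhx: "x \<otimes>\<^bsub>PGL2 UNIV\<^esub> h \<otimes>\<^bsub>PGL2 UNIV\<^esub> x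
        = pgl_mat a (s * (\<xi>\<^sub>k * D)) (s * - v) (- a)"
      by (simp only: a_def uv mult_1_right)
    have "a * - a - s * (\<xi>\<^sub>k * D) * (s * - v) = s\<^sup>2 * D * (\<xi>\<^sub>k * v) - a\<^sup>2"
      by (simp add: power2_eq_square algebra_simps)
    \<comment> \<open>With \<open>w = \<omega>\<^sub>l\<^sup>2\<close> this is
      \<open>4 D w - (D + w)^2 = - (D - w)^2\<close>, multiplied by \<open>D^2\<close>.\<close>
    also have "\<dots> = - (D\<^sup>2 * (D - \<omega>\<^sub>l\<^sup>2)\<^sup>2)"
      by (simp add: uv a_def s_def power2_eq_square algebra_simps)
    finally have "a * - a - s * (\<xi>\<^sub>k * D) * (s * - v) \<noteq> 0"
      using D_eq nz by simp
    \<comment> \<open>The off-diagonal entries force the proportionality scalar to be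
      \<open>s\<close>, and the zero diagonal of \<open>h y\<close> forces
      \<open>a = 0\<close>.\<close>
    then have "x \<otimes>\<^bsub>PGL2 UNIV\<^esub> h \<otimes>\<^bsub>PGL2 UNIV\<^esub> x = h \<otimes>\<^bsub>PGL2 UNIV\<^esub> y
        \<longleftrightarrow> a = 0 \<and> s \<noteq> 0"
      unfolding xhx hy using nz by (subst pgl_mat_eq_iff) auto
    \<comment> \<open>If \<open>D + \<omega>\<^sub>l\<^sup>2 = 0\<close>, then
      \<open>\<omega>\<^sub>l\<close> is nonzero because D is, and \<open>s \<noteq> 0\<close>
      follows as 2 is nonzero.\<close>
    also have "\<dots> \<longleftrightarrow> D + \<omega>\<^sub>l\<^sup>2 = 0"
      using nz two by (auto simp: a_def s_def)
    also have "\<dots> \<longleftrightarrow> \<omega>\<^sub>k\<^sup>2 + 2 * \<omega>\<^sub>l\<^sup>2 = 4"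
      unfolding assms(20) by (auto simp: algebra_simps)
    finally show ?thesis
      unfolding pow_G mult_G .
  qed
  then show ?thesis
    using regular by (auto simp: moebius_regular_def)
qed

end
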